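(* Let $H$ be a complex Hilbert space, let $n\geq 1$, and let $S_{i},T_{i}\in B_{1}(H)$ for $i=1,2,\ldots,n$ be arbitrary trace class operators. Then $$\left|\mathrm{Tr}\left(\sum_{i=1}^{n}S_{i}T_{i}^{*}\right)\right|^{2}\leq \mathrm{Tr}\left(\sum_{i=1}^{n}S_{i}S_{i}^{*}\right)\mathrm{Tr}\left(\sum_{i=1}^{n}T_{i}T_{i}^{*}\right).$$
   Context: $B_{1}(H)$ is the set of trace class operators on $H$, i.e. bounded operators $A$ with $\sum_{i}\langle |A|e_{i},e_{i}\rangle<\infty$ for an orthonormal basis $\{e_i\}$ of $H$, where $|A|=(A^*A)^{1/2}$. The trace of $A\in B_1(H)$ is $\mathrm{Tr}(A)=\sum_{i}\langle Ae_{i},e_{i}\rangle$. *)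

theory Defs
  imports "HOL-Analysis.Analysis" "HOL-Library.Complex_Order"
begin

text \<open>Complex Hilbert spaces of arbitrary dimension. The inner product is linear in its first
  argument, and the norm, with respect to which the space is complete, is the one it induces.\<close>

class complex_hilbert = banach +
  fixes scaleC :: "complex \<Rightarrow> 'a \<Rightarrow> 'a"  (infixr \<open>*\<^sub>C\<close> 75)
    and cinner :: "'a \<Rightarrow> 'a \<Rightarrow> complex"
  assumes scaleC_add_right: "c *\<^sub>C (x + y) = c *\<^sub>C x + c *\<^sub>C y"
    and scaleC_add_left: "(c + d) *\<^sub>C x = c *\<^sub>C x + d *\<^sub>C x"
    and scaleC_scaleC: "c *\<^sub>C d *\<^sub>C x = (c * d) *\<^sub>C x"
    and scaleC_one: "1 *\<^sub>C x = x"
    and scaleR_scaleC: "r *\<^sub>R x = complex_of_real r *\<^sub>C x"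
    and cinner_commute: "cinner x y = cnj (cinner y x)"
    and cinner_add_left: "cinner (x + y) z = cinner x z + cinner y z"
    and cinner_scaleC_left: "cinner (c *\<^sub>C x) y = c * cinner x y"
    and cinner_self: "cinner x x = complex_of_real ((norm x)\<^sup>2)"

instantiation complex :: complex_hilbert
begin

definition scaleC_complex :: "complex \<Rightarrow> complex \<Rightarrow> complex"
  where "scaleC_complex c x = c * x"

definition cinner_complex :: "complex \<Rightarrow> complex \<Rightarrow> complex"
  where "cinner_complex x y = x * cnj y"

instance
  by standard
    (simp_all add: scaleC_complex_def cinner_complex_def algebra_simps scaleR_conv_of_real
      complex_norm_square flip: of_real_power)

end

definition orthonormal_basis :: "'a::complex_hilbert set \<Rightarrow> bool"
  where "orthonormal_basis B \<longleftrightarrow>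
    (\<forall>e\<in>B. \<forall>f\<in>B. cinner e f = (if e = f then 1 else 0)) \<and>
    closure (module.span scaleC B) = UNIV"

text \<open>The elements of \<^typ>\<open>'a \<Rightarrow>\<^sub>L 'a\<close> are the bounded real-linear operators, so the bounded
  operators on a complex Hilbert space are those among them that commute with complex scalars.\<close>

definition complex_linear :: "('a::complex_hilbert \<Rightarrow>\<^sub>L 'a) \<Rightarrow> bool"
  where "complex_linear A \<longleftrightarrow> (\<forall>c x. A (c *\<^sub>C x) = c *\<^sub>C A x)"

definition adj :: "('a::complex_hilbert \<Rightarrow>\<^sub>L 'a) \<Rightarrow> ('a \<Rightarrow>\<^sub>L 'a)"
  where "adj A = (THE B :: 'a \<Rightarrow>\<^sub>L 'a. \<forall>x y. cinner (A x) y = cinner x (B y))"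

text \<open>The order on \<^typ>\<open>complex\<close> relates only numbers with equal imaginary parts, so
  \<open>0 \<le> z\<close> says that \<open>z\<close> is real and nonnegative.\<close>

definition positive_op :: "('a::complex_hilbert \<Rightarrow>\<^sub>L 'a) \<Rightarrow> bool"
  where "positive_op P \<longleftrightarrow> complex_linear P \<and> (\<forall>x. 0 \<le> cinner (P x) x)"

definition sqrt_op :: "('a::complex_hilbert \<Rightarrow>\<^sub>L 'a) \<Rightarrow> ('a \<Rightarrow>\<^sub>L 'a)"
  where "sqrt_op A = (THE P. positive_op P \<and> P o\<^sub>L P = A)"

definition abs_op :: "('a::complex_hilbert \<Rightarrow>\<^sub>L 'a) \<Rightarrow> ('a \<Rightarrow>\<^sub>L 'a)"
  where "abs_op A = sqrt_op (adj A o\<^sub>L A)"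

text \<open>Since the terms are nonnegative, summability says that the sum is finite.\<close>

definition trace_class :: "('a::complex_hilbert \<Rightarrow>\<^sub>L 'a) \<Rightarrow> bool"
  where "trace_class A \<longleftrightarrow> complex_linear A \<and>
    (\<exists>B. orthonormal_basis B \<and> (\<lambda>e. cinner (abs_op A e) e) summable_on B)"

text \<open>The trace of a trace class operator does not depend on the orthonormal basis: it is the one
  number that is the sum of the diagonal entries with respect to each of them.\<close>

definition trace_op :: "('a::complex_hilbert \<Rightarrow>\<^sub>L 'a) \<Rightarrow> complex"
  where "trace_op A = (THE t. \<forall>B. orthonormal_basis B \<longrightarrow> ((\<lambda>e. cinner (A e) e) has_sum t) B)"

end

theory Submission
  imports Defs
begin

text \<open>A trace class operator \<open>A\<close> is Hilbert--Schmidt: with \<open>P = |A|\<close> the Cauchy--Schwarz inequality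
  for the form \<open>\<langle>P x, y\<rangle>\<close> gives \<open>\<parallel>A e\<parallel>\<^sup>2 = \<parallel>P e\<parallel>\<^sup>2 \<le> \<parallel>P\<parallel> \<langle>P e, e\<rangle>\<close>. For Hilbert--Schmidt operators,
  expanding in two orthonormal bases shows that the diagonal of \<open>S T\<^sup>*\<close> in any basis sums to
  \<open>\<Sum>\<^sub>e \<langle>S e, T e\<rangle>\<close> over any other, so both sides of the inequality are expressed through the
  inner product of the families \<open>S\<^sub>i e\<close> and \<open>T\<^sub>i e\<close> in an \<open>\<ell>\<^sup>2\<close> sum of copies of \<open>H\<close>, where it is the
  Cauchy--Schwarz inequality.\<close>

subsection \<open>Inner products and positive operators\<close>

interpretation cmodule: module "scaleC :: complex \<Rightarrow> 'a \<Rightarrow> 'a::complex_hilbert"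
  by standard (simp_all add: scaleC_add_right scaleC_add_left scaleC_scaleC scaleC_one)

lemma scaleC_minus_one: "(- 1) *\<^sub>C x = - (x::'a::complex_hilbert)"
  using scaleR_scaleC[of "-1" x] by simp

lemma cinner_add_right: "cinner x (y + z) = cinner x y + cinner (x::'a::complex_hilbert) z"
  by (metis cinner_add_left cinner_commute complex_cnj_add)

lemma cinner_scaleC_right: "cinner x (c *\<^sub>C y) = cnj c * cinner (x::'a::complex_hilbert) y"
  by (metis cinner_scaleC_left cinner_commute complex_cnj_mult)

lemma cinner_zero_left [simp]: "cinner 0 (y::'a::complex_hilbert) = 0"
  using cinner_scaleC_left[of 0 0 y] by simp

lemma cinner_zero_right [simp]: "cinner (y::'a::complex_hilbert) 0 = 0"
  using cinner_scaleC_right[of y 0 0] by simp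

lemma cinner_minus_left: "cinner (- x) y = - cinner (x::'a::complex_hilbert) y"
  by (metis cinner_scaleC_left mult_minus1 scaleC_minus_one)

lemma cinner_minus_right: "cinner x (- y) = - cinner (x::'a::complex_hilbert) y"
  by (metis cinner_minus_left cinner_commute complex_cnj_minus)

lemma cinner_diff_left: "cinner (x - y) z = cinner x z - cinner (y::'a::complex_hilbert) z"
  using cinner_add_left[of x "- y" z] by (simp add: cinner_minus_left)

lemma cinner_diff_right: "cinner x (y - z) = cinner x y - cinner (x::'a::complex_hilbert) z"
  using cinner_add_right[of x y "- z"] by (simp add: cinner_minus_right)

lemma cinner_scaleR_left: "cinner (r *\<^sub>R x) y = of_real r * cinner (x::'a::complex_hilbert) y"
  by (simp add: scaleR_scaleC cinner_scaleC_left)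

lemma cinner_scaleR_right: "cinner x (r *\<^sub>R y) = of_real r * cinner (x::'a::complex_hilbert) y"
  by (simp add: scaleR_scaleC cinner_scaleC_right)

lemma cinner_sum_left: "cinner (sum f I) (y::'a::complex_hilbert) = (\<Sum>i\<in>I. cinner (f i) y)"
  by (induction I rule: infinite_finite_induct) (simp_all add: cinner_add_left)

lemma cinner_sum_right: "cinner (y::'a::complex_hilbert) (sum f I) = (\<Sum>i\<in>I. cinner y (f i))"
  by (induction I rule: infinite_finite_induct) (simp_all add: cinner_add_right)

lemmas cinner_simps = cinner_add_left cinner_add_right cinner_diff_left cinner_diff_right
  cinner_scaleC_left cinner_scaleC_right cinner_scaleR_left cinner_scaleR_right
  cinner_minus_left cinner_minus_right

lemma cinner_eqI:
  assumes "\<And>z. cinner z x = cinner z (y::'a::complex_hilbert)"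
  shows "x = y"
proof -
  have "cinner (x - y) (x - y) = 0"
    using assms by (simp add: cinner_diff_right)
  then show ?thesis by (simp add: cinner_self)
qed

lemma Re_cinner_self: "Re (cinner x x) = (norm (x::'a::complex_hilbert))\<^sup>2"
  by (simp add: cinner_self)

lemma norm_diff_sq:
  "(norm (x - y))\<^sup>2 = (norm x)\<^sup>2 - 2 * Re (cinner x y) + (norm (y::'a::complex_hilbert))\<^sup>2"
proof -
  have "Re (cinner y x) = Re (cinner x y)"
    by (subst cinner_commute) simp
  then show ?thesis
    by (simp add: cinner_simps flip: Re_cinner_self)
qed

lemma norm_add_sq:
  "(norm (x + y))\<^sup>2 = (norm x)\<^sup>2 + 2 * Re (cinner x y) + (norm (y::'a::complex_hilbert))\<^sup>2"
  using norm_diff_sq[of x "- y"] by (simp add: cinner_minus_right)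

lemma of_real_cmod_sq: "(complex_of_real (cmod z))\<^sup>2 = z * cnj z"
  by (metis complex_norm_square of_real_power)

lemma norm_scaleC: "norm (c *\<^sub>C x) = cmod c * norm (x::'a::complex_hilbert)"
proof -
  have "complex_of_real ((norm (c *\<^sub>C x))\<^sup>2) = c * (cnj c * cinner x x)"
    unfolding cinner_self[symmetric] by (simp add: cinner_scaleC_left cinner_scaleC_right)
  also have "\<dots> = complex_of_real ((cmod c * norm x)\<^sup>2)"
    by (simp add: cinner_self power_mult_distrib of_real_cmod_sq)
  finally have "complex_of_real ((norm (c *\<^sub>C x))\<^sup>2) = complex_of_real ((cmod c * norm x)\<^sup>2)" .
  then have "(norm (c *\<^sub>C x))\<^sup>2 = (cmod c * norm x)\<^sup>2"
    using of_real_eq_iff by blast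
  then show ?thesis
    by (simp add: power2_eq_iff_nonneg)
qed

section \<open>Positive operators and their sesquilinear forms\<close>

lemma positive_op_ge0: "positive_op P \<Longrightarrow> 0 \<le> Re (cinner (P x) x)"
  and positive_op_Im: "positive_op P \<Longrightarrow> Im (cinner (P x) x) = 0"
  by (simp_all add: positive_op_def less_eq_complex_def)

text \<open>Polarisation: realness of the form of \<open>P\<close> at \<open>x + y\<close> relates
  the imaginary parts, and at \<open>x + \<i> *\<^sub>C y\<close> the real parts.\<close>

lemma positive_op_hermitian:
  assumes "positive_op P"
  shows "cinner (P x) y = cinner x (P y)"
proof -
  have lin: "P (c *\<^sub>C x) = c *\<^sub>C P x" for c x
    using assms by (simp add: positive_op_def complex_linear_def)
  note im = positive_op_Im[OF assms]
  have 1: "Im (cinner (P x) y) + Im (cinner (P y) x) = 0"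
    using im[of "x + y"] im[of x] im[of y] by (simp add: blinfun.add_right cinner_simps)
  have 2: "Re (cinner (P y) x) - Re (cinner (P x) y) = 0"
    using im[of "x + \<i> *\<^sub>C y"] im[of x] im[of y]
    by (simp add: blinfun.add_right cinner_simps lin)
  have "cinner (P x) y = cnj (cinner (P y) x)"
    using 1 2 by (simp add: complex_eq_iff)
  then show ?thesis
    by (simp flip: cinner_commute)
qed

text \<open>Discriminant argument along a line through \<open>x\<close> with real parameter
  \<open>t\<close>. The direction is \<open>c *\<^sub>C y\<close> rather than \<open>y\<close>,
  which makes the cross term a real multiple of \<open>(cmod c)\<^sup>2\<close>.\<close>

lemma positive_op_Cauchy_Schwarz:
  assumes "positive_op P"
  shows "(cmod (cinner (P x) y))\<^sup>2 \<le> Re (cinner (P x) x) * Re (cinner (P y) y)"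
proof -
  define c where "c = cinner (P x) y"
  define a where "a = Re (cinner (P x) x)"
  define b where "b = Re (cinner (P y) y)"
  have lin: "P (c *\<^sub>C x) = c *\<^sub>C P x" for c x
    using assms by (simp add: positive_op_def complex_linear_def)
  have yx: "cinner (P y) x = cnj c"
    using positive_op_hermitian[OF assms, of y x] by (metis c_def cinner_commute)
  have bb: "cinner (P y) y = of_real b" and aa: "cinner (P x) x = of_real a"
    using positive_op_Im[OF assms] by (simp_all add: b_def a_def complex_eq_iff)
  have quad: "0 \<le> a - 2 * t * (cmod c)\<^sup>2 + t\<^sup>2 * (cmod c)\<^sup>2 * b" for t :: real
  proof -
    define z where "z = x - (of_real t * c) *\<^sub>C y"
    have "cinner (P z) z = of_real (a - 2 * t * (cmod c)\<^sup>2 + t\<^sup>2 * (cmod c)\<^sup>2 * b)"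
      unfolding z_def
      by (simp add: blinfun.diff_right lin cinner_simps yx aa bb of_real_cmod_sq flip: c_def)
        (simp add: algebra_simps power2_eq_square)
    then show ?thesis
      using positive_op_ge0[OF assms, of z] by simp
  qed
  have b0: "0 \<le> b"
    using positive_op_ge0[OF assms] by (simp add: b_def)
  show ?thesis
  proof (cases "b = 0")
    case True
    have "c = 0"
    proof (rule ccontr)
      assume "c \<noteq> 0"
      then have "(cmod c)\<^sup>2 > 0" by simp
      then show False
        \<comment> \<open>For \<open>b = 0\<close> the right-hand side of \<open>quad\<close> is
          affine in \<open>t\<close>, and this \<open>t\<close> makes it \<open>-1\<close>.\<close>
        using quad[of "(a + 1) / (2 * (cmod c)\<^sup>2)"] True by simp
    qed
    then show ?thesis
      using True by (simp flip: c_def b_def)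
  next
    case False
    with b0 have "b > 0" by simp
    then show ?thesis
      \<comment> \<open>\<open>1 / b\<close> minimises the quadratic in \<open>t\<close>.\<close>
      using quad[of "1 / b"] by (simp add: power2_eq_square field_simps flip: c_def a_def b_def)
  qed
qed

text \<open>Cauchy--Schwarz for the form of \<open>P\<close> at \<open>x\<close> and
  \<open>P x\<close>, after which one factor \<open>(norm (P x))\<^sup>2\<close> cancels. The
  constant \<open>k\<close> bounds the form rather than the operator norm, so the case
  \<open>k = 1\<close> can serve to prove that an operator is a contraction.\<close>

lemma positive_op_norm_le:
  assumes "positive_op P" and "\<And>y. Re (cinner (P y) y) \<le> k * (norm y)\<^sup>2"
  shows "(norm (P x))\<^sup>2 \<le> k * Re (cinner (P x) x)"
proof (cases "P x = 0")
  case False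
  define N where "N = (norm (P x))\<^sup>2"
  have "N > 0" using False by (simp add: N_def)
  have "N * N \<le> Re (cinner (P x) x) * Re (cinner (P (P x)) (P x))"
    using positive_op_Cauchy_Schwarz[OF assms(1), of x "P x"]
    unfolding cinner_self[of "P x"] N_def by (simp only: norm_of_real) (simp add: power2_eq_square)
  also have "\<dots> \<le> Re (cinner (P x) x) * (k * N)"
    unfolding N_def by (intro mult_left_mono assms(2) positive_op_ge0 assms(1))
  finally have "N * N \<le> N * (k * Re (cinner (P x) x))"
    by (simp add: mult_ac)
  then show ?thesis
    unfolding N_def[symmetric] using \<open>N > 0\<close> by (simp only: mult_le_cancel_left_pos)
qed simp

text \<open>Makes the ordinary Cauchy--Schwarz inequality an instance of the one for positive
  forms.\<close>

lemma positive_op_id: "positive_op id_blinfun"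
  by (simp add: positive_op_def complex_linear_def cinner_self less_eq_complex_def)

lemma cinner_Cauchy_Schwarz: "cmod (cinner x y) \<le> norm x * norm (y::'a::complex_hilbert)"
proof -
  have "(cmod (cinner x y))\<^sup>2 \<le> (norm x * norm y)\<^sup>2"
    using positive_op_Cauchy_Schwarz[OF positive_op_id, of x y]
    by (simp add: cinner_self power_mult_distrib)
  then show ?thesis
    by (rule power2_le_imp_le) simp
qed

lemma bounded_bilinear_cinner:
  "bounded_bilinear (cinner :: 'a::complex_hilbert \<Rightarrow> 'a \<Rightarrow> complex)"
  by standard (auto simp: cinner_simps scaleR_conv_of_real intro!: exI[of _ 1] cinner_Cauchy_Schwarz)

lemmas bounded_linear_cinner_left = bounded_bilinear.bounded_linear_left[OF bounded_bilinear_cinner]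
lemmas tendsto_cinner = bounded_bilinear.tendsto[OF bounded_bilinear_cinner]

lemma bounded_linear_scaleC: "bounded_linear (\<lambda>x. c *\<^sub>C (x::'a::complex_hilbert))"
  by (rule bounded_linear_intro[where K = "cmod c"])
    (simp_all add: scaleC_add_right scaleR_scaleC scaleC_scaleC norm_scaleC mult_ac)

lemma Re_cinner_blinfun_le:
  fixes A :: "'a::complex_hilbert \<Rightarrow>\<^sub>L 'a"
  shows "Re (cinner (A x) x) \<le> norm A * (norm x)\<^sup>2"
proof -
  have "Re (cinner (A x) x) \<le> norm (A x) * norm x"
    using complex_Re_le_cmod cinner_Cauchy_Schwarz order_trans by blast
  also have "\<dots> \<le> (norm A * norm x) * norm x"
    by (intro mult_right_mono norm_blinfun) simp
  finally show ?thesis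
    by (simp add: power2_eq_square mult_ac)
qed

lemma positive_op_bounded:
  assumes "positive_op P"
  shows "(norm (P x))\<^sup>2 \<le> norm P * Re (cinner (P x) x)"
  by (rule positive_op_norm_le[OF assms Re_cinner_blinfun_le])

subsection \<open>Adjoints\<close>

text \<open>The representing vector minimises \<open>\<parallel>x\<parallel>\<^sup>2 - 2 \<phi> x\<close>; minimising sequences are Cauchy by the
  parallelogram law.\<close>

lemma Riesz_real:
  fixes \<phi> :: "'a::complex_hilbert \<Rightarrow> real"
  assumes "bounded_linear \<phi>"
  shows "\<exists>u. \<forall>x. \<phi> x = Re (cinner x u)"
proof -
  interpret \<phi>: bounded_linear \<phi> by fact
  define J where "J x = (norm x)\<^sup>2 - 2 * \<phi> x" for x
  define m where "m = Inf (range J)"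
  obtain K where K: "\<bar>\<phi> x\<bar> \<le> norm x * K" for x
    using \<phi>.bounded by auto
  have "- (K\<^sup>2) \<le> J x" for x
  proof -
    \<comment> \<open>Completing the square:
      \<open>J x \<ge> (norm x - K)\<^sup>2 - K\<^sup>2\<close>.\<close>
    have "0 \<le> (norm x - K)\<^sup>2" by simp
    then show ?thesis
      using K[of x] by (simp add: J_def power2_diff)
  qed
  then have bdd: "bdd_below (range J)"
    by (intro bdd_belowI2)
  have m_le: "m \<le> J x" for x
    unfolding m_def using bdd by (intro cInf_lower) auto
  \<comment> \<open>\<open>J\<close> is at least \<open>m\<close> at the midpoint of
    \<open>x\<close> and \<open>y\<close> too, so near-minimisers lie close together.\<close>
  have para: "(norm (x - y))\<^sup>2 \<le> 2 * (J x - m) + 2 * (J y - m)" for x y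
  proof -
    have "(norm (x - y))\<^sup>2 = 2 * J x + 2 * J y - 4 * J ((1/2) *\<^sub>R (x + y))"
      using norm_diff_sq[of x y] norm_add_sq[of x y]
      by (simp add: J_def \<phi>.scaleR \<phi>.add power_mult_distrib power_divide del: scaleR_right_distrib scaleR_add_right)
        (simp add: field_simps)
    also have "\<dots> \<le> 2 * J x + 2 * J y - 4 * m"
      using m_le by (intro diff_left_mono mult_left_mono) auto
    finally show ?thesis by simp
  qed
  have "\<exists>x. J x < m + 1 / real (Suc k)" for k
  proof -
    have "Inf (range J) < m + 1 / real (Suc k)"
      by (simp add: m_def)
    then show ?thesis
      by (subst (asm) cInf_less_iff) (use bdd in auto)
  qed
  then obtain X where X: "J (X k) < m + 1 / real (Suc k)" for k
    by metis
  have "Cauchy X"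
  proof (rule metric_CauchyI)
    fix e :: real assume "0 < e"
    then obtain N where N: "1 / real (Suc N) < e\<^sup>2 / 4"
      using nat_approx_posE[of "e\<^sup>2 / 4"] by auto
    have near: "J (X i) - m < e\<^sup>2 / 4" if "i \<ge> N" for i
    proof -
      have "1 / real (Suc i) \<le> 1 / real (Suc N)"
        using that by (simp add: divide_simps)
      with N have "1 / real (Suc i) < e\<^sup>2 / 4"
        by (rule order_le_less_trans[rotated])
      then show ?thesis
        using X[of i] by simp
    qed
    have "dist (X i) (X j) < e" if "i \<ge> N" "j \<ge> N" for i j
    proof -
      have "(norm (X i - X j))\<^sup>2 < e\<^sup>2"
        using para[of "X i" "X j"] near[OF that(1)] near[OF that(2)] by simp
      then show ?thesis
        using \<open>0 < e\<close> by (simp add: dist_norm power2_less_imp_less)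
    qed
    then show "\<exists>N. \<forall>i\<ge>N. \<forall>j\<ge>N. dist (X i) (X j) < e" by blast
  qed
  then obtain u where u: "X \<longlonglongrightarrow> u"
    using Cauchy_convergent_iff convergent_def by blast
  have "(\<lambda>k. J (X k)) \<longlonglongrightarrow> J u"
    unfolding J_def by (intro tendsto_intros \<phi>.tendsto u)
  moreover have "(\<lambda>k. m + 1 / real (Suc k)) \<longlonglongrightarrow> m + 0"
    using LIMSEQ_inverse_real_of_nat by (intro tendsto_add) (simp_all add: inverse_eq_divide)
  ultimately have "J u \<le> m + 0"
    by (rule LIMSEQ_le) (use X less_imp_le in blast)
  then have min: "J u \<le> J x" for x
    using m_le[of x] by simp
  show ?thesis
  proof (intro exI allI)
    fix h
    define d where "d = \<phi> h - Re (cinner h u)"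
    \<comment> \<open>Minimality of \<open>u\<close> along the line
      \<open>u + t *\<^sub>R h\<close>; a nonzero linear coefficient \<open>d\<close> would win for
      small \<open>t\<close>.\<close>
    have quad: "2 * t * d \<le> t\<^sup>2 * (norm h)\<^sup>2" for t
    proof -
      have "Re (cinner h u) = Re (cinner u h)"
        by (subst cinner_commute) simp
      then show ?thesis
        using min[of "u + t *\<^sub>R h"] norm_add_sq[of u "t *\<^sub>R h"]
        by (simp add: J_def d_def \<phi>.add \<phi>.scaleR cinner_simps power_mult_distrib algebra_simps)
    qed
    have "d = 0"
    proof (cases "h = 0")
      case True
      then show ?thesis by (simp add: d_def)
    next
      case False
      define N where "N = (norm h)\<^sup>2"
      have "N > 0" using False by (simp add: N_def)
      have "2 * (d / N) * d \<le> (d / N)\<^sup>2 * N"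
        unfolding N_def by (rule quad)
      then have "d\<^sup>2 \<le> 0"
        using \<open>N > 0\<close> by (simp add: power2_eq_square field_simps)
      then show ?thesis by simp
    qed
    then show "\<phi> h = Re (cinner h u)"
      by (simp add: d_def)
  qed
qed

text \<open>The real part of a complex-linear functional determines it: its value at
  \<open>\<i> *\<^sub>C x\<close> has real part \<open>- Im (f x)\<close>.\<close>

lemma Riesz:
  fixes f :: "'a::complex_hilbert \<Rightarrow> complex"
  assumes "bounded_linear f" and scale: "\<And>c x. f (c *\<^sub>C x) = c * f x"
  shows "\<exists>u. \<forall>x. f x = cinner x u"
proof -
  obtain u where u: "Re (f x) = Re (cinner x u)" for x
    using Riesz_real[OF bounded_linear_compose[OF bounded_linear_Re assms(1)]] by auto
  have "Im (f x) = Im (cinner x u)" for x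
    using u[of "\<i> *\<^sub>C x"] by (simp add: scale cinner_simps)
  then show ?thesis
    using u complex_eq_iff by blast
qed

text \<open>Justifies the definite description in \<open>adj\<close>: Riesz gives a representing
  vector \<open>g y\<close> for each \<open>y\<close>, and uniqueness of these vectors makes
  \<open>g\<close> additive and homogeneous and the adjoint unique.\<close>

lemma cinner_adj_right:
  assumes "complex_linear A"
  shows "cinner (A x) y = cinner x (adj A y)"
proof -
  have "\<exists>u. \<forall>x. cinner (A x) y = cinner x u" for y
  proof (rule Riesz)
    show "bounded_linear (\<lambda>x. cinner (A x) y)"
      by (rule bounded_linear_compose[OF bounded_linear_cinner_left blinfun.bounded_linear_right])
  qed (use assms in \<open>simp add: complex_linear_def cinner_scaleC_left\<close>)
  then obtain g where g: "cinner (A x) y = cinner x (g y)" for x y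
    by metis
  have "bounded_linear g"
  proof (rule bounded_linear_intro)
    show "g (x + y) = g x + g y" for x y
      by (rule cinner_eqI) (simp add: cinner_simps flip: g)
    show "g (r *\<^sub>R x) = r *\<^sub>R g x" for r x
      by (rule cinner_eqI) (simp add: cinner_simps flip: g)
    show "norm (g y) \<le> norm y * norm A" for y
    proof (cases "g y = 0")
      case False
      \<comment> \<open>The defining identity is tested at \<open>x = g y\<close>; one factor
        \<open>norm (g y)\<close> then cancels.\<close>
      have "(norm (g y))\<^sup>2 = Re (cinner (A (g y)) y)"
        by (simp add: g Re_cinner_self)
      also have "\<dots> \<le> norm (A (g y)) * norm y"
        using complex_Re_le_cmod cinner_Cauchy_Schwarz order_trans by blast
      also have "\<dots> \<le> (norm A * norm (g y)) * norm y"
        by (intro mult_right_mono norm_blinfun) simp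
      finally show ?thesis
        using False by (simp add: power2_eq_square mult_ac)
    qed simp
  qed
  then have "\<forall>x y. cinner (A x) y = cinner x (Blinfun g y)"
    by (simp add: bounded_linear_Blinfun_apply g)
  then have "\<exists>!B :: 'a \<Rightarrow>\<^sub>L 'a. \<forall>x y. cinner (A x) y = cinner x (B y)"
  proof (rule ex1I)
    fix B :: "'a \<Rightarrow>\<^sub>L 'a"
    assume "\<forall>x y. cinner (A x) y = cinner x (B y)"
    then have "cinner x (B y) = cinner x (Blinfun g y)" for x y
      using \<open>\<forall>x y. cinner (A x) y = cinner x (Blinfun g y)\<close> by simp
    then show "B = Blinfun g"
      by (rule blinfun_eqI[OF cinner_eqI])
  qed
  from theI'[OF this] show ?thesis
    unfolding adj_def by blast
qed

lemma cinner_adj_left: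
  assumes "complex_linear A"
  shows "cinner (adj A x) y = cinner x (A y)"
  by (subst (1 2) cinner_commute) (simp add: cinner_adj_right[OF assms])

lemma complex_linear_adj:
  assumes "complex_linear A"
  shows "complex_linear (adj A)"
  unfolding complex_linear_def
proof (rule allI[OF allI[OF cinner_eqI]])
  fix c x z
  show "cinner z (adj A (c *\<^sub>C x)) = cinner z (c *\<^sub>C adj A x)"
    by (simp add: cinner_scaleC_right flip: cinner_adj_right[OF assms])
qed

lemma adj_adj:
  assumes "complex_linear A"
  shows "adj (adj A) = A"
proof (rule blinfun_eqI[OF cinner_eqI])
  fix x z
  show "cinner z (adj (adj A) x) = cinner z (A x)"
    by (simp only: cinner_adj_left[OF assms] cinner_adj_right[OF complex_linear_adj[OF assms], symmetric])
qed

subsection \<open>Square roots of positive operators\<close>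

definition self_adjoint_op :: "('a::complex_hilbert \<Rightarrow>\<^sub>L 'a) \<Rightarrow> bool"
  where "self_adjoint_op A \<longleftrightarrow> (\<forall>x y. cinner (A x) y = cinner x (A y))"

lemma scaleR_scaleC_commute: "r *\<^sub>R c *\<^sub>C x = c *\<^sub>C r *\<^sub>R (x::'a::complex_hilbert)"
  by (simp add: scaleR_scaleC scaleC_scaleC mult.commute)

lemma positive_opI:
  assumes "complex_linear P" "self_adjoint_op P" "\<And>x. 0 \<le> Re (cinner (P x) x)"
  shows "positive_op P"
proof -
  have "Im (cinner (P x) x) = 0" for x
  proof -
    have "cinner (P x) x = cnj (cinner (P x) x)"
      using cinner_commute[of "P x" x] assms(2) by (simp add: self_adjoint_op_def)
    from arg_cong[OF this, of Im] show ?thesis by simp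
  qed
  then show ?thesis
    using assms by (simp add: positive_op_def less_eq_complex_def)
qed

text \<open>For a contraction \<open>X\<close> the iterates converge to a solution \<open>Y\<close> of \<open>2 Y = X + Y\<^sup>2\<close>, that is,
  \<open>(1 - Y)\<^sup>2 = 1 - X\<close>; the scalar iteration for \<open>X = 1\<close> dominates all the norms.\<close>

primrec sqrt_iter :: "('a::complex_hilbert \<Rightarrow>\<^sub>L 'a) \<Rightarrow> nat \<Rightarrow> ('a \<Rightarrow>\<^sub>L 'a)"
  where
    "sqrt_iter X 0 = 0"
  | "sqrt_iter X (Suc n) = (1/2) *\<^sub>R (X + (sqrt_iter X n o\<^sub>L sqrt_iter X n))"

primrec sqrt_majorant :: "nat \<Rightarrow> real"
  where
    "sqrt_majorant 0 = 0"
  | "sqrt_majorant (Suc n) = (1 + (sqrt_majorant n)\<^sup>2) / 2"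

lemma sqrt_majorant_bounds: "0 \<le> sqrt_majorant n \<and> sqrt_majorant n \<le> 1"
  by (induction n) (simp_all add: power_le_one)

lemma sqrt_majorant_incseq: "incseq sqrt_majorant"
proof (rule incseq_SucI)
  fix n
  have "0 \<le> (1 - sqrt_majorant n)\<^sup>2" by simp
  then show "sqrt_majorant n \<le> sqrt_majorant (Suc n)"
    by (simp add: power2_diff)
qed

text \<open>Each iterate is a polynomial in \<open>X\<close>. This serves twice: the iterates
  commute with each other, and in the limit the square root commutes with everything that commutes
  with the original operator.\<close>

lemma sqrt_iter_commute:
  fixes K X :: "'a::complex_hilbert \<Rightarrow>\<^sub>L 'a"
  assumes "\<And>x. K (X x) = X (K x)"
  shows "K (sqrt_iter X n x) = sqrt_iter X n (K x)"
  by (induction n arbitrary: x)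
    (simp_all add: blinfun.bilinear_simps assms)

lemma complex_linear_sqrt_iter:
  assumes "complex_linear X"
  shows "complex_linear (sqrt_iter X n)"
  using assms unfolding complex_linear_def
  by (induction n) (simp_all add: blinfun.bilinear_simps scaleR_right_distrib scaleC_add_right scaleR_scaleC_commute)

lemma self_adjoint_sqrt_iter:
  assumes "self_adjoint_op X"
  shows "self_adjoint_op (sqrt_iter X n)"
  using assms unfolding self_adjoint_op_def
  by (induction n) (simp_all add: blinfun.bilinear_simps cinner_simps)

lemma norm_sqrt_iter_le:
  assumes "norm X \<le> 1"
  shows "norm (sqrt_iter X n) \<le> sqrt_majorant n"
proof (induction n)
  case (Suc n)
  have "norm (sqrt_iter X n o\<^sub>L sqrt_iter X n) \<le> sqrt_majorant n * sqrt_majorant n"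
    using Suc by (intro order_trans[OF norm_blinfun_compose] mult_mono) (use sqrt_majorant_bounds in auto)
  then have "norm (X + (sqrt_iter X n o\<^sub>L sqrt_iter X n)) \<le> 1 + sqrt_majorant n * sqrt_majorant n"
    using assms by (intro norm_triangle_le add_mono)
  then show ?case
    by (simp add: power2_eq_square)
qed simp

text \<open>The iterates commute, so consecutive increments factor as a difference of squares.\<close>

lemma norm_sqrt_iter_diff_le:
  assumes "norm X \<le> 1"
  shows "norm (sqrt_iter X (Suc n) - sqrt_iter X n) \<le> sqrt_majorant (Suc n) - sqrt_majorant n"
proof (induction n)
  case 0
  then show ?case using assms by simp
next
  case (Suc n)
  define U where "U = sqrt_iter X (Suc n)"
  define V where "V = sqrt_iter X n"
  have "sqrt_iter X n (X x) = X (sqrt_iter X n x)" for n x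
    by (rule sqrt_iter_commute[symmetric]) simp
  then have UV: "U (V x) = V (U x)" for x
    unfolding U_def V_def by (rule sqrt_iter_commute)
  have "sqrt_iter X (Suc (Suc n)) = (1/2) *\<^sub>R (X + (U o\<^sub>L U))"
    "sqrt_iter X (Suc n) = (1/2) *\<^sub>R (X + (V o\<^sub>L V))"
    by (simp_all add: U_def V_def)
  then have eq: "sqrt_iter X (Suc (Suc n)) - sqrt_iter X (Suc n) = (1/2) *\<^sub>R ((U - V) o\<^sub>L (U + V))"
    by (simp only:) (intro blinfun_eqI, simp add: blinfun.bilinear_simps UV algebra_simps)
  have "norm ((U - V) o\<^sub>L (U + V))
      \<le> (sqrt_majorant (Suc n) - sqrt_majorant n) * (sqrt_majorant (Suc n) + sqrt_majorant n)"
    using Suc norm_sqrt_iter_le[OF assms, of "Suc n"] norm_sqrt_iter_le[OF assms, of n]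
    by (intro order_trans[OF norm_blinfun_compose] mult_mono norm_triangle_le)
      (auto simp: U_def V_def incseq_SucD[OF sqrt_majorant_incseq] simp del: sqrt_iter.simps sqrt_majorant.simps)
  also have "\<dots> = (sqrt_majorant (Suc n))\<^sup>2 - (sqrt_majorant n)\<^sup>2"
    by (simp add: algebra_simps power2_eq_square del: sqrt_majorant.simps)
  finally have "norm ((U - V) o\<^sub>L (U + V)) \<le> (sqrt_majorant (Suc n))\<^sup>2 - (sqrt_majorant n)\<^sup>2" .
  moreover have "sqrt_majorant (Suc (Suc n)) - sqrt_majorant (Suc n)
      = ((sqrt_majorant (Suc n))\<^sup>2 - (sqrt_majorant n)\<^sup>2) / 2"
    unfolding sqrt_majorant.simps(2)[of "Suc n"] by (simp add: field_simps)
  ultimately show ?case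
    unfolding eq by simp
qed

text \<open>The bounded monotone majorant converges, so its increments are summable and dominate
  those of the iterates. As the iteration starts at \<open>0\<close>, the partial sums of the
  increments are the iterates.\<close>

lemma convergent_sqrt_iter:
  assumes "norm X \<le> 1"
  shows "convergent (sqrt_iter X)"
proof -
  have "convergent sqrt_majorant"
    by (rule Bseq_mono_convergent)
      (use sqrt_majorant_bounds sqrt_majorant_incseq in \<open>auto intro!: BseqI'[of _ 1] simp: incseq_def\<close>)
  then have "summable (\<lambda>n. sqrt_majorant (Suc n) - sqrt_majorant n)"
    using telescope_summable convergent_def by blast
  then have "summable (\<lambda>n. sqrt_iter X (Suc n) - sqrt_iter X n)"
    by (rule summable_comparison_test') (rule norm_sqrt_iter_diff_le[OF assms])
  then have "convergent (\<lambda>n. \<Sum>k<n. sqrt_iter X (Suc k) - sqrt_iter X k)"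
    by (simp only: summable_iff_convergent)
  then show ?thesis
    by (simp only: sum_lessThan_telescope) simp
qed

text \<open>Every listed property is inherited from the iterates by passing to the limit. The
  commutation property is what uniqueness of square roots will rest on.\<close>

lemma contraction_half_square:
  fixes X :: "'a::complex_hilbert \<Rightarrow>\<^sub>L 'a"
  assumes "complex_linear X" "self_adjoint_op X" "norm X \<le> 1"
  obtains Y where "complex_linear Y" "self_adjoint_op Y" "norm Y \<le> 1"
    "\<And>x. 2 *\<^sub>R Y x = X x + Y (Y x)"
    "\<And>(K::'a \<Rightarrow>\<^sub>L 'a) x. (\<And>x. K (X x) = X (K x)) \<Longrightarrow> K (Y x) = Y (K x)"
proof -
  obtain Y where Y: "sqrt_iter X \<longlonglongrightarrow> Y"
    using convergent_sqrt_iter[OF assms(3)] convergent_def by blast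
  have Yx: "(\<lambda>n. sqrt_iter X n x) \<longlonglongrightarrow> Y x" for x
    by (intro blinfun.tendsto Y tendsto_const)
  show thesis
  proof
    show "complex_linear Y"
      unfolding complex_linear_def
    proof (rule allI[OF allI])
      fix c x
      have "(\<lambda>n. sqrt_iter X n (c *\<^sub>C x)) \<longlonglongrightarrow> c *\<^sub>C Y x"
        using bounded_linear.tendsto[OF bounded_linear_scaleC Yx] complex_linear_sqrt_iter[OF assms(1)]
        by (simp add: complex_linear_def)
      then show "Y (c *\<^sub>C x) = c *\<^sub>C Y x"
        using Yx LIMSEQ_unique by blast
    qed
    show "self_adjoint_op Y"
      unfolding self_adjoint_op_def
    proof (rule allI[OF allI])
      fix x y
      have "(\<lambda>n. cinner (sqrt_iter X n x) y) \<longlonglongrightarrow> cinner x (Y y)"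
        using tendsto_cinner[OF tendsto_const Yx] self_adjoint_sqrt_iter[OF assms(2)]
        by (simp add: self_adjoint_op_def)
      then show "cinner (Y x) y = cinner x (Y y)"
        using tendsto_cinner[OF Yx tendsto_const] LIMSEQ_unique by blast
    qed
    show "norm Y \<le> 1"
      by (rule LIMSEQ_le_const2[OF tendsto_norm[OF Y]])
        (use norm_sqrt_iter_le[OF assms(3)] sqrt_majorant_bounds order_trans in blast)
    have "(\<lambda>n. sqrt_iter X (Suc n)) \<longlonglongrightarrow> (1/2) *\<^sub>R (X + (Y o\<^sub>L Y))"
      unfolding sqrt_iter.simps
      by (intro tendsto_intros bounded_bilinear.tendsto[OF bounded_bilinear_blinfun_compose] Y)
    then have "Y = (1/2) *\<^sub>R (X + (Y o\<^sub>L Y))"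
      using LIMSEQ_Suc[OF Y] LIMSEQ_unique by blast
    then have "Y x = ((1/2) *\<^sub>R (X + (Y o\<^sub>L Y))) x" for x
      by (rule arg_cong)
    then have "Y x = (1/2) *\<^sub>R (X x + Y (Y x))" for x
      by (simp add: blinfun.bilinear_simps)
    then have "2 *\<^sub>R Y x = 2 *\<^sub>R (1/2) *\<^sub>R (X x + Y (Y x))" for x
      by (rule arg_cong)
    then show "2 *\<^sub>R Y x = X x + Y (Y x)" for x
      by (simp only: scaleR_scaleR) simp
    show "K (Y x) = Y (K x)" if "\<And>x. K (X x) = X (K x)" for K :: "'a \<Rightarrow>\<^sub>L 'a" and x
    proof -
      have "(\<lambda>n. sqrt_iter X n (K x)) \<longlonglongrightarrow> K (Y x)"
        using blinfun.tendsto[OF tendsto_const Yx, of K] sqrt_iter_commute[OF that] by simp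
      then show ?thesis
        using Yx LIMSEQ_unique by blast
    qed
  qed
qed

text \<open>Rescaling reduces to \<open>X = 1 - A / N\<close>, a contraction because its form lies
  between \<open>0\<close> and that of the identity. With
  \<open>(1 - Y)\<^sup>2 = 1 - X = A / N\<close>, the root is \<open>sqrt N\<close> times
  \<open>1 - Y\<close>.\<close>

lemma positive_op_sqrt_exists:
  fixes A :: "'a::complex_hilbert \<Rightarrow>\<^sub>L 'a"
  assumes A: "positive_op A"
  obtains P where "positive_op P" "P o\<^sub>L P = A"
    "\<And>(K::'a \<Rightarrow>\<^sub>L 'a) x. (\<And>x. K (A x) = A (K x)) \<Longrightarrow> K (P x) = P (K x)"
proof (cases "A = 0")
  case True
  then show ?thesis
    using A that[of 0] by simp
next
  case False
  define N where "N = norm A"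
  have N: "N > 0" using False by (simp add: N_def)
  define X where "X = id_blinfun - (1/N) *\<^sub>R A"
  have Xx: "X x = x - (1/N) *\<^sub>R A x" for x
    by (simp add: X_def blinfun.bilinear_simps)
  have linA: "A (c *\<^sub>C x) = c *\<^sub>C A x" for c x
    using A by (simp add: positive_op_def complex_linear_def)
  have linX: "complex_linear X"
    by (simp add: complex_linear_def Xx linA scaleR_scaleC_commute cmodule.scale_right_diff_distrib)
  have saX: "self_adjoint_op X"
    by (simp add: self_adjoint_op_def Xx cinner_simps positive_op_hermitian[OF A])
  have ReX: "Re (cinner (X x) x) = (norm x)\<^sup>2 - Re (cinner (A x) x) / N" for x
    by (simp add: Xx cinner_simps Re_cinner_self)
  have posX: "positive_op X"
  proof (rule positive_opI[OF linX saX])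
    show "0 \<le> Re (cinner (X x) x)" for x
      using Re_cinner_blinfun_le[of A x] N by (simp add: ReX N_def field_simps)
  qed
  have ReX_le: "Re (cinner (X x) x) \<le> 1 * (norm x)\<^sup>2" for x
    using positive_op_ge0[OF A, of x] N by (simp add: ReX)
  have normX: "norm X \<le> 1"
  proof (rule norm_blinfun_bound)
    fix x
    have "(norm (X x))\<^sup>2 \<le> (norm x)\<^sup>2"
      using order_trans[OF positive_op_norm_le[OF posX ReX_le] mult_left_mono[OF ReX_le]] by simp
    then show "norm (X x) \<le> 1 * norm x"
      using power2_le_imp_le[of "norm (X x)" "norm x"] by simp
  qed simp
  obtain Y where Y: "complex_linear Y" "self_adjoint_op Y" "norm Y \<le> 1"
    "\<And>x. 2 *\<^sub>R Y x = X x + Y (Y x)"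
    "\<And>(K::'a \<Rightarrow>\<^sub>L 'a) x. (\<And>x. K (X x) = X (K x)) \<Longrightarrow> K (Y x) = Y (K x)"
    by (rule contraction_half_square[OF linX saX normX]) (blast intro: that)
  define P where "P = sqrt N *\<^sub>R (id_blinfun - Y)"
  have Px: "P x = sqrt N *\<^sub>R (x - Y x)" for x
    by (simp add: P_def blinfun.bilinear_simps)
  show ?thesis
  proof
    show "positive_op P"
    proof (rule positive_opI)
      show "complex_linear P"
        using Y(1) by (simp add: complex_linear_def Px scaleR_scaleC_commute flip: cmodule.scale_right_diff_distrib)
      show "self_adjoint_op P"
        using Y(2) by (simp add: self_adjoint_op_def Px cinner_simps)
      fix x
      \<comment> \<open>\<open>norm Y \<le> 1\<close> makes the form of \<open>1 - Y\<close>
        nonnegative.\<close>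
      have "Re (cinner (Y x) x) \<le> 1 * (norm x)\<^sup>2"
        by (rule order_trans[OF Re_cinner_blinfun_le mult_right_mono[OF Y(3)]]) simp
      then show "0 \<le> Re (cinner (P x) x)"
        using N by (simp add: Px cinner_simps Re_cinner_self)
    qed
    show "P o\<^sub>L P = A"
    proof (rule blinfun_eqI)
      fix x
      have "P (P x) = N *\<^sub>R (x - 2 *\<^sub>R Y x + Y (Y x))"
        using N by (simp add: Px blinfun.bilinear_simps algebra_simps scaleR_2)
      also have "\<dots> = A x"
        unfolding Y(4) using N by (simp add: Xx)
      finally show "(P o\<^sub>L P) x = A x" by simp
    qed
    show "K (P x) = P (K x)" if "\<And>x. K (A x) = A (K x)" for K :: "'a \<Rightarrow>\<^sub>L 'a" and x
    proof -
      have "K (X x) = X (K x)" for x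
        by (simp add: Xx blinfun.bilinear_simps that)
      then have "K (Y x) = Y (K x)"
        by (rule Y(5))
      then show ?thesis
        by (simp add: Px blinfun.bilinear_simps)
    qed
  qed
qed

text \<open>For \<open>y = P x - Q x\<close> commutation gives \<open>P y + Q y = 0\<close>. Both
  forms are nonnegative, hence vanish at \<open>y\<close>, so \<open>P y = Q y = 0\<close>; moving
  \<open>P\<close> and \<open>Q\<close> across the inner product yields
  \<open>cinner y y = 0\<close>.\<close>

lemma positive_op_sqrt_unique:
  assumes P: "positive_op P" "P o\<^sub>L P = A" and Q: "positive_op Q" "Q o\<^sub>L Q = A"
    and commute: "\<And>x. Q (P x) = P (Q x)"
  shows "Q = P"
proof (rule blinfun_eqI)
  fix x
  have sq: "P (P x) = Q (Q x)" for x
    using P(2) Q(2) by (metis blinfun_apply_blinfun_compose)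
  define y where "y = P x - Q x"
  have "P y + Q y = 0"
    by (simp add: y_def blinfun.diff_right sq commute)
  then have "cinner (P y) y + cinner (Q y) y = 0"
    by (simp flip: cinner_add_left)
  then have "Re (cinner (P y) y) + Re (cinner (Q y) y) = 0"
    by (metis plus_complex.sel(1) zero_complex.sel(1))
  then have "Re (cinner (P y) y) = 0" "Re (cinner (Q y) y) = 0"
    using positive_op_ge0[OF P(1), of y] positive_op_ge0[OF Q(1), of y] by simp_all
  then have "P y = 0" "Q y = 0"
    using positive_op_bounded[OF P(1), of y] positive_op_bounded[OF Q(1), of y] by simp_all
  then have "cinner y y = 0"
    unfolding y_def cinner_diff_left
    by (simp add: positive_op_hermitian[OF P(1)] positive_op_hermitian[OF Q(1)] flip: y_def)
  then show "Q x = P x"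
    by (simp add: cinner_self y_def)
qed

lemma sqrt_op:
  fixes A :: "'a::complex_hilbert \<Rightarrow>\<^sub>L 'a"
  assumes "positive_op A"
  shows "positive_op (sqrt_op A)" "sqrt_op A o\<^sub>L sqrt_op A = A"
proof -
  obtain P where P: "positive_op P" "P o\<^sub>L P = A"
    "\<And>(K::'a \<Rightarrow>\<^sub>L 'a) x. (\<And>x. K (A x) = A (K x)) \<Longrightarrow> K (P x) = P (K x)"
    by (rule positive_op_sqrt_exists[OF assms]) (blast intro: that)
  have "\<exists>!P. positive_op P \<and> P o\<^sub>L P = A"
  proof (rule ex1I[of _ P])
    fix Q assume Q: "positive_op Q \<and> Q o\<^sub>L Q = A"
    \<comment> \<open>A competitor \<open>Q\<close> commutes with \<open>A\<close>, being a root of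
      it, and \<open>P\<close> commutes with whatever commutes with \<open>A\<close>.\<close>
    have "Q (P x) = P (Q x)" for x
      by (rule P(3)) (use Q in auto)
    then show "Q = P"
      using Q P by (intro positive_op_sqrt_unique[of P A Q]) auto
  qed (use P in simp)
  from theI'[OF this] show "positive_op (sqrt_op A)" "sqrt_op A o\<^sub>L sqrt_op A = A"
    unfolding sqrt_op_def by blast+
qed

lemma positive_op_adj_compose:
  assumes "complex_linear A"
  shows "positive_op (adj A o\<^sub>L A)"
  using assms complex_linear_adj[OF assms]
  by (auto simp: positive_op_def complex_linear_def cinner_adj_left[OF assms] cinner_self
      less_eq_complex_def)

text \<open>Both squared norms equal \<open>cinner x (adj A (A x))\<close>. This transfers bounds on
  \<open>abs_op A\<close> to \<open>A\<close> without a polar decomposition.\<close>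

lemma norm_abs_op:
  assumes "complex_linear A"
  shows "norm (abs_op A x) = norm (A x)"
proof -
  define P where "P = abs_op A"
  have P: "positive_op P" "P o\<^sub>L P = adj A o\<^sub>L A"
    using sqrt_op[OF positive_op_adj_compose[OF assms]] by (simp_all add: P_def abs_op_def)
  have "P (P x) = adj A (A x)"
    using P(2) by (metis blinfun_apply_blinfun_compose)
  then have "cinner (P x) (P x) = cinner (A x) (A x)"
    by (simp add: positive_op_hermitian[OF P(1)] flip: cinner_adj_right[OF assms])
  then have "(norm (P x))\<^sup>2 = (norm (A x))\<^sup>2"
    by (metis Re_cinner_self)
  then show ?thesis
    by (simp add: P_def)
qed

subsection \<open>Orthonormal expansions\<close>

text \<open>Pythagoras: the error \<open>d\<close> of the Fourier sum is orthogonal to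
  \<open>Y\<close>, and any other combination changes the error by a vector \<open>w\<close> in the
  span of \<open>Y\<close>.\<close>

lemma orthonormal_best_approximation:
  fixes x :: "'a::complex_hilbert"
  assumes orth: "\<And>e f. e \<in> Y \<Longrightarrow> f \<in> Y \<Longrightarrow> cinner e f = (if e = f then 1 else 0)"
    and "finite Y"
  shows "norm (x - (\<Sum>e\<in>Y. cinner x e *\<^sub>C e)) \<le> norm (x - (\<Sum>e\<in>Y. c e *\<^sub>C e))"
proof -
  define d where "d = x - (\<Sum>e\<in>Y. cinner x e *\<^sub>C e)"
  define w where "w = (\<Sum>e\<in>Y. (cinner x e - c e) *\<^sub>C e)"
  have orth_d: "cinner d f = 0" if "f \<in> Y" for f
  proof -
    have "(\<Sum>e\<in>Y. cinner x e * cinner e f) = (\<Sum>e\<in>Y. if e = f then cinner x e else 0)"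
      using orth that by (intro sum.cong) auto
    also have "\<dots> = cinner x f"
      using that \<open>finite Y\<close> by (simp add: sum.delta)
    finally show ?thesis
      by (simp add: d_def cinner_diff_left cinner_sum_left cinner_scaleC_left)
  qed
  have "cinner d w = 0"
    by (simp add: w_def cinner_sum_right cinner_scaleC_right orth_d)
  moreover have "x - (\<Sum>e\<in>Y. c e *\<^sub>C e) = d + w"
    by (simp add: d_def w_def cmodule.scale_left_diff_distrib sum_subtractf)
  ultimately have "(norm d)\<^sup>2 \<le> (norm (x - (\<Sum>e\<in>Y. c e *\<^sub>C e)))\<^sup>2"
    by (simp add: norm_add_sq)
  then show ?thesis
    unfolding d_def by (rule power2_le_imp_le) simp
qed

text \<open>Density supplies one finite combination within \<open>\<epsilon>\<close> of
  \<open>x\<close>. Over every larger finite set the Fourier sum is at least as good, which is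
  exactly convergence along finite subsets.\<close>

lemma orthonormal_basis_expansion:
  fixes x :: "'a::complex_hilbert"
  assumes "orthonormal_basis B"
  shows "((\<lambda>e. cinner x e *\<^sub>C e) has_sum x) B"
  unfolding has_sum_def tendsto_iff eventually_finite_subsets_at_top
proof (intro allI impI)
  fix \<epsilon> :: real assume "\<epsilon> > 0"
  have orth: "cinner e f = (if e = f then 1 else 0)" if "e \<in> B" "f \<in> B" for e f
    using assms that by (simp add: orthonormal_basis_def)
  have "x \<in> closure (cmodule.span B)"
    using assms by (simp add: orthonormal_basis_def)
  then obtain y where "y \<in> cmodule.span B" "dist y x < \<epsilon>"
    using \<open>\<epsilon> > 0\<close> by (auto simp: closure_approachable)
  then obtain F c where F: "finite F" "F \<subseteq> B" and y: "y = (\<Sum>e\<in>F. c e *\<^sub>C e)"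
    by (auto simp: cmodule.span_explicit)
  have "dist (\<Sum>e\<in>Y. cinner x e *\<^sub>C e) x < \<epsilon>" if Y: "finite Y" "F \<subseteq> Y" "Y \<subseteq> B" for Y
  proof -
    \<comment> \<open>Padding by zero turns the combination over \<open>F\<close> into a competitor
      over \<open>Y\<close>.\<close>
    define c' where "c' e = (if e \<in> F then c e else 0)" for e
    have "y = (\<Sum>e\<in>Y. c' e *\<^sub>C e)"
      unfolding y using Y by (intro sum.mono_neutral_cong_left) (auto simp: c'_def)
    moreover have "norm (x - (\<Sum>e\<in>Y. cinner x e *\<^sub>C e)) \<le> norm (x - (\<Sum>e\<in>Y. c' e *\<^sub>C e))"
      using Y orth by (intro orthonormal_best_approximation) blast+
    ultimately show ?thesis
      using \<open>dist y x < \<epsilon>\<close> by (simp add: dist_norm norm_minus_commute)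
  qed
  then show "\<exists>X. finite X \<and> X \<subseteq> B \<and>
      (\<forall>Y. finite Y \<and> X \<subseteq> Y \<and> Y \<subseteq> B \<longrightarrow> dist (\<Sum>e\<in>Y. cinner x e *\<^sub>C e) x < \<epsilon>)"
    using F by blast
qed

lemma has_sum_Parseval:
  assumes "orthonormal_basis B"
  shows "((\<lambda>e. cinner x e * cinner e y) has_sum cinner x y) B"
  using has_sum_bounded_linear[OF bounded_linear_cinner_left orthonormal_basis_expansion[OF assms]]
  by (simp add: cinner_scaleC_left)

lemma has_sum_Parseval_norm:
  assumes "orthonormal_basis B"
  shows "((\<lambda>e. (cmod (cinner x e))\<^sup>2) has_sum (norm x)\<^sup>2) B"
proof -
  have "cinner x e * cinner e x = complex_of_real ((cmod (cinner x e))\<^sup>2)" for e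
    using of_real_cmod_sq[of "cinner x e"] cinner_commute[of e x] by simp
  then show ?thesis
    using has_sum_Parseval[OF assms, of x x] by (simp only: cinner_self has_sum_of_real_iff)
qed

subsection \<open>Hilbert--Schmidt operators\<close>

text \<open>One basis suffices here, matching \<open>trace_class\<close>; independence of the basis
  is \<open>Hilbert_Schmidt_summable\<close>.\<close>

definition Hilbert_Schmidt :: "('a::complex_hilbert \<Rightarrow>\<^sub>L 'a) \<Rightarrow> bool"
  where "Hilbert_Schmidt A \<longleftrightarrow> complex_linear A \<and>
    (\<exists>B. orthonormal_basis B \<and> (\<lambda>e. (norm (A e))\<^sup>2) summable_on B)"

lemma trace_class_Hilbert_Schmidt:
  assumes "trace_class A"
  shows "Hilbert_Schmidt A"
proof -
  have lin: "complex_linear A"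
    using assms by (simp add: trace_class_def)
  obtain B where B: "orthonormal_basis B" "(\<lambda>e. cinner (abs_op A e) e) summable_on B"
    using assms by (auto simp: trace_class_def)
  have pos: "positive_op (abs_op A)"
    using sqrt_op(1)[OF positive_op_adj_compose[OF lin]] by (simp add: abs_op_def)
  have "(\<lambda>e. Re (cinner (abs_op A e) e)) summable_on B"
    using summable_on_bounded_linear[OF bounded_linear_Re B(2)] .
  then have "(\<lambda>e. norm (abs_op A) * Re (cinner (abs_op A e) e)) summable_on B"
    by (rule summable_on_cmult_right)
  then have "(\<lambda>e. (norm (A e))\<^sup>2) summable_on B"
    by (rule summable_on_comparison_test)
      (use positive_op_bounded[OF pos] norm_abs_op[OF lin] in auto)
  with B(1) lin show ?thesis
    by (auto simp: Hilbert_Schmidt_def)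
qed

text \<open>Both sums are the double sum of \<open>\<langle>S e, f\<rangle> \<langle>f, T e\<rangle>\<close> over \<open>e \<in> B\<close> and \<open>f \<in> B'\<close>,
  which converges absolutely because it is dominated by two double sums of squares.\<close>

lemma Hilbert_Schmidt_double_sum:
  fixes S T :: "'a::complex_hilbert \<Rightarrow>\<^sub>L 'a"
  assumes B: "orthonormal_basis (B :: 'a set)" and B': "orthonormal_basis (B' :: 'a set)"
    and lin: "complex_linear S" "complex_linear T"
    and S: "(\<lambda>e. (norm (S e))\<^sup>2) summable_on B" and T: "(\<lambda>e. (norm (T e))\<^sup>2) summable_on B"
  obtains t where "((\<lambda>e. cinner (S e) (T e)) has_sum t) B"
    "((\<lambda>f. cinner (adj T f) (adj S f)) has_sum t) B'"
proof -
  define h where "h = (\<lambda>(e, f). cinner (S e) f * cinner f (T e))"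
  \<comment> \<open>By Parseval in \<open>B'\<close>, the inner sum over \<open>f\<close> is
    \<open>(norm (R e))\<^sup>2\<close>.\<close>
  have sq: "(\<lambda>(e, f). (cmod (cinner (R e) f))\<^sup>2) summable_on B \<times> B'"
    if "(\<lambda>e. (norm (R e))\<^sup>2) summable_on B" for R :: "'a \<Rightarrow>\<^sub>L 'a"
    using has_sum_Parseval_norm[OF B'] that
    by (intro summable_on_SigmaI[where g = "\<lambda>e. (norm (R e))\<^sup>2"]) auto
  have "(\<lambda>p. norm (h p)) summable_on B \<times> B'"
  proof (rule summable_on_comparison_test[OF summable_on_add[OF sq[OF S] sq[OF T]]])
    fix p :: "'a \<times> 'a"
    obtain e f where p: "p = (e, f)" by (cases p)
    have "cmod (cinner f (T e)) = cmod (cinner (T e) f)"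
      by (subst cinner_commute) simp
    moreover have "u * v \<le> u\<^sup>2 + v\<^sup>2" for u v :: real
      using sum_squares_bound[of u v] zero_le_power2[of u] zero_le_power2[of v] by linarith
    ultimately show "norm (h p) \<le> (case p of (e, f) \<Rightarrow> (cmod (cinner (S e) f))\<^sup>2)
        + (case p of (e, f) \<Rightarrow> (cmod (cinner (T e) f))\<^sup>2)"
      by (simp add: h_def p norm_mult)
  qed simp
  then obtain t where t: "(h has_sum t) (B \<times> B')"
    using abs_summable_summable summable_on_def by blast
  show thesis
  proof
    show "((\<lambda>e. cinner (S e) (T e)) has_sum t) B"
      using has_sum_Parseval[OF B'] by (intro has_sum_SigmaD[OF t]) (simp add: h_def)
    have t': "((\<lambda>(f, e). h (e, f)) has_sum t) (B' \<times> B)"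
      using t has_sum_swap by blast
    show "((\<lambda>f. cinner (adj T f) (adj S f)) has_sum t) B'"
    proof (rule has_sum_SigmaD[OF t'])
      fix f :: 'a
      \<comment> \<open>In the other order of summation, Parseval in \<open>B\<close> applies once
        both operators are moved onto \<open>f\<close>.\<close>
      have "h (e, f) = cinner (adj T f) e * cinner e (adj S f)" for e
        by (simp add: h_def cinner_adj_right[OF lin(1)] cinner_adj_left[OF lin(2)])
      then show "((\<lambda>e. case (f, e) of (f, e) \<Rightarrow> h (e, f)) has_sum cinner (adj T f) (adj S f)) B"
        using has_sum_Parseval[OF B] by simp
    qed
  qed
qed

text \<open>The double sum with \<open>T = S\<close>: passing to the adjoint allows a change of
  basis.\<close>

lemma summable_on_norm_sq_adj:
  fixes S :: "'a::complex_hilbert \<Rightarrow>\<^sub>L 'a"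
  assumes "orthonormal_basis (B :: 'a set)" "orthonormal_basis (B' :: 'a set)" "complex_linear S"
    and "(\<lambda>e. (norm (S e))\<^sup>2) summable_on B"
  shows "(\<lambda>f. (norm (adj S f))\<^sup>2) summable_on B'"
proof -
  obtain t where "((\<lambda>f. cinner (adj S f) (adj S f)) has_sum t) B'"
    using Hilbert_Schmidt_double_sum[OF assms(1,2,3,3,4,4)] .
  from has_sum_bounded_linear[OF bounded_linear_Re this] show ?thesis
    by (auto simp: Re_cinner_self summable_on_def)
qed

text \<open>Two passages to the adjoint, the second one changing the basis, lead back to
  \<open>S\<close>.\<close>

lemma Hilbert_Schmidt_summable:
  fixes S :: "'a::complex_hilbert \<Rightarrow>\<^sub>L 'a"
  assumes "Hilbert_Schmidt S" "orthonormal_basis (B :: 'a set)"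
  shows "(\<lambda>e. (norm (S e))\<^sup>2) summable_on B"
proof -
  obtain B0 where B0: "orthonormal_basis B0" "(\<lambda>e. (norm (S e))\<^sup>2) summable_on B0"
    and lin: "complex_linear S"
    using assms(1) by (auto simp: Hilbert_Schmidt_def)
  have "(\<lambda>e. (norm (adj S e))\<^sup>2) summable_on B0"
    by (rule summable_on_norm_sq_adj[OF B0(1) B0(1) lin B0(2)])
  from summable_on_norm_sq_adj[OF B0(1) assms(2) complex_linear_adj[OF lin] this] show ?thesis
    by (simp add: adj_adj[OF lin])
qed

section \<open>Traces as sums over one fixed basis\<close>

text \<open>The given basis \<open>B\<close> pins down the value: a condition ranging over no bases
  would hold for every number.\<close>

lemma trace_op_eqI:
  fixes A :: "'a::complex_hilbert \<Rightarrow>\<^sub>L 'a"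
  assumes "orthonormal_basis (B :: 'a set)"
    and "\<And>B'. orthonormal_basis B' \<Longrightarrow> ((\<lambda>e. cinner (A e) e) has_sum t) B'"
  shows "trace_op A = t"
  unfolding trace_op_def
proof (rule the_equality)
  show "s = t" if "\<forall>B. orthonormal_basis B \<longrightarrow> ((\<lambda>e. cinner (A e) e) has_sum s) B" for s
    by (rule has_sum_unique[OF that[rule_format, OF assms(1)] assms(2)[OF assms(1)]])
qed (use assms(2) in blast)

lemma has_sum_sum:
  fixes f :: "'i \<Rightarrow> 'b \<Rightarrow> 'c::topological_comm_monoid_add"
  assumes "\<And>i. i \<in> I \<Longrightarrow> (f i has_sum t i) B"
  shows "((\<lambda>x. \<Sum>i\<in>I. f i x) has_sum (\<Sum>i\<in>I. t i)) B"
  using assms by (induction I rule: infinite_finite_induct) (simp_all add: has_sum_add)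

text \<open>Removes the adjoints: the trace becomes an inner product of the families
  \<open>S i e\<close> and \<open>T i e\<close> over any chosen basis.\<close>

lemma trace_op_sum_compose_adj:
  fixes S T :: "'i \<Rightarrow> ('a::complex_hilbert \<Rightarrow>\<^sub>L 'a)"
  assumes B: "orthonormal_basis (B :: 'a set)"
    and S: "\<And>i. i \<in> I \<Longrightarrow> Hilbert_Schmidt (S i)"
    and T: "\<And>i. i \<in> I \<Longrightarrow> Hilbert_Schmidt (T i)"
  shows "((\<lambda>e. \<Sum>i\<in>I. cinner (S i e) (T i e)) has_sum trace_op (\<Sum>i\<in>I. S i o\<^sub>L adj (T i))) B"
proof -
  have "\<exists>t. ((\<lambda>e. cinner (S i e) (T i e)) has_sum t) B \<and>
      (\<forall>B'. orthonormal_basis B' \<longrightarrow> ((\<lambda>f. cinner ((S i o\<^sub>L adj (T i)) f) f) has_sum t) B')"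
    if i: "i \<in> I" for i
  proof -
    have lin: "complex_linear (S i)" "complex_linear (T i)"
      using S[OF i] T[OF i] by (auto simp: Hilbert_Schmidt_def)
    note sum = Hilbert_Schmidt_summable[OF S[OF i] B] Hilbert_Schmidt_summable[OF T[OF i] B]
    obtain t where t: "((\<lambda>e. cinner (S i e) (T i e)) has_sum t) B"
      using Hilbert_Schmidt_double_sum[OF B B lin sum] .
    have "((\<lambda>f. cinner ((S i o\<^sub>L adj (T i)) f) f) has_sum t) B'" if B': "orthonormal_basis B'" for B'
    proof -
      obtain s where "((\<lambda>e. cinner (S i e) (T i e)) has_sum s) B"
        and s: "((\<lambda>f. cinner (adj (T i) f) (adj (S i) f)) has_sum s) B'"
        using Hilbert_Schmidt_double_sum[OF B B' lin sum] .
      \<comment> \<open>\<open>s\<close> may depend on \<open>B'\<close>, but it is also the sum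
        over the fixed basis \<open>B\<close>, so all bases give the same trace.\<close>
      then have "s = t"
        using t has_sum_unique by blast
      with s show ?thesis
        by (simp add: cinner_adj_right[OF lin(1)])
    qed
    with t show ?thesis by blast
  qed
  then obtain t where t: "\<And>i. i \<in> I \<Longrightarrow> ((\<lambda>e. cinner (S i e) (T i e)) has_sum t i) B"
    and t': "\<And>i B'. i \<in> I \<Longrightarrow> orthonormal_basis B' \<Longrightarrow>
      ((\<lambda>f. cinner ((S i o\<^sub>L adj (T i)) f) f) has_sum t i) B'"
    by metis
  have "trace_op (\<Sum>i\<in>I. S i o\<^sub>L adj (T i)) = (\<Sum>i\<in>I. t i)"
  proof (rule trace_op_eqI[OF B])
    fix B' :: "'a set" assume "orthonormal_basis B'"
    then show "((\<lambda>e. cinner ((\<Sum>i\<in>I. S i o\<^sub>L adj (T i)) e) e) has_sum (\<Sum>i\<in>I. t i)) B'"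
      unfolding blinfun.sum_left cinner_sum_left by (intro has_sum_sum t')
  qed
  then show ?thesis
    by (simp only:) (intro has_sum_sum t)
qed

section \<open>The Cauchy--Schwarz inequality for traces\<close>

text \<open>Cauchy--Schwarz in \<open>'a\<close> for each term, then for the real families of
  norms.\<close>

lemma norm_sum_cinner_le:
  fixes u v :: "'b \<Rightarrow> 'a::complex_hilbert"
  shows "cmod (\<Sum>p\<in>Z. cinner (u p) (v p))
    \<le> sqrt (\<Sum>p\<in>Z. (norm (u p))\<^sup>2) * sqrt (\<Sum>p\<in>Z. (norm (v p))\<^sup>2)"
proof -
  have "cmod (\<Sum>p\<in>Z. cinner (u p) (v p)) \<le> (\<Sum>p\<in>Z. \<bar>norm (u p)\<bar> * \<bar>norm (v p)\<bar>)"
    by (rule sum_norm_le) (simp add: cinner_Cauchy_Schwarz)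
  also have "\<dots> \<le> L2_set (\<lambda>p. norm (u p)) Z * L2_set (\<lambda>p. norm (v p)) Z"
    by (rule L2_set_mult_ineq)
  finally show ?thesis
    by (simp add: L2_set_def)
qed

lemma has_sum_cmod_le:
  fixes f :: "'b \<Rightarrow> complex"
  assumes "(f has_sum t) B" and "\<And>F. finite F \<Longrightarrow> F \<subseteq> B \<Longrightarrow> cmod (sum f F) \<le> k"
  shows "cmod t \<le> k"
proof (rule tendsto_upperbound)
  show "((\<lambda>F. cmod (sum f F)) \<longlongrightarrow> cmod t) (finite_subsets_at_top B)"
    using assms(1) by (intro tendsto_norm) (simp add: has_sum_def)
  show "\<forall>\<^sub>F F in finite_subsets_at_top B. cmod (sum f F) \<le> k"
    by (rule eventually_finite_subsets_at_top_weakI) (rule assms(2))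
qed simp

text \<open>Only finite sums over \<open>F \<times> I\<close> are estimated; the bound is uniform in
  \<open>F\<close> and so survives the limit over finite subsets of \<open>B\<close>.\<close>

lemma Hilbert_Schmidt_trace_Cauchy_Schwarz:
  fixes S T :: "'i \<Rightarrow> ('a::complex_hilbert \<Rightarrow>\<^sub>L 'a)"
  assumes B: "orthonormal_basis (B :: 'a set)"
    and S: "\<And>i. i \<in> I \<Longrightarrow> Hilbert_Schmidt (S i)"
    and T: "\<And>i. i \<in> I \<Longrightarrow> Hilbert_Schmidt (T i)"
  shows "complex_of_real ((cmod (trace_op (\<Sum>i\<in>I. S i o\<^sub>L adj (T i))))\<^sup>2)
    \<le> trace_op (\<Sum>i\<in>I. S i o\<^sub>L adj (S i)) * trace_op (\<Sum>i\<in>I. T i o\<^sub>L adj (T i))"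
proof -
  \<comment> \<open>Stated for a generic family \<open>R\<close>, to be used for \<open>S\<close>
    and for \<open>T\<close>: the trace is a nonnegative real that dominates all finite partial
    sums.\<close>
  have sq: "\<exists>a\<ge>0. trace_op (\<Sum>i\<in>I. R i o\<^sub>L adj (R i)) = complex_of_real a \<and>
      (\<forall>F. finite F \<longrightarrow> F \<subseteq> B \<longrightarrow> (\<Sum>(e, i)\<in>F \<times> I. (norm (R i e))\<^sup>2) \<le> a)"
    if R: "\<And>i. i \<in> I \<Longrightarrow> Hilbert_Schmidt (R i)" for R :: "'i \<Rightarrow> ('a \<Rightarrow>\<^sub>L 'a)"
  proof -
    define g where "g e = (\<Sum>i\<in>I. (norm (R i e))\<^sup>2)" for e
    have "g summable_on B"
      unfolding g_def using has_sum_sum[OF has_sum_infsum[OF Hilbert_Schmidt_summable[OF R B]]]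
      by (rule has_sum_imp_summable)
    then obtain a where a: "(g has_sum a) B"
      using summable_on_def by blast
    have g_nonneg: "0 \<le> g e" for e
      by (simp add: g_def sum_nonneg)
    have "complex_of_real (g e) = (\<Sum>i\<in>I. cinner (R i e) (R i e))" for e
      by (simp add: g_def cinner_self)
    then have "((\<lambda>e. complex_of_real (g e)) has_sum trace_op (\<Sum>i\<in>I. R i o\<^sub>L adj (R i))) B"
      using trace_op_sum_compose_adj[OF B, where S = R and T = R, OF R R] by (simp only:)
    then have "trace_op (\<Sum>i\<in>I. R i o\<^sub>L adj (R i)) = complex_of_real a"
      using has_sum_of_real[OF a] has_sum_unique by blast
    moreover have "0 \<le> a"
      using has_sum_nonneg[OF a] g_nonneg by blast
    moreover have "(\<Sum>(e, i)\<in>F \<times> I. (norm (R i e))\<^sup>2) \<le> a" if "finite F" "F \<subseteq> B" for F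
      using finite_sum_le_has_sum[OF a that(1) that(2)] g_nonneg
      by (simp add: g_def sum.cartesian_product)
    ultimately show ?thesis by blast
  qed
  obtain a where a: "a \<ge> 0" "trace_op (\<Sum>i\<in>I. S i o\<^sub>L adj (S i)) = complex_of_real a"
    "\<And>F. finite F \<Longrightarrow> F \<subseteq> B \<Longrightarrow> (\<Sum>(e, i)\<in>F \<times> I. (norm (S i e))\<^sup>2) \<le> a"
    using sq[of S, OF S] by auto
  obtain b where b: "b \<ge> 0" "trace_op (\<Sum>i\<in>I. T i o\<^sub>L adj (T i)) = complex_of_real b"
    "\<And>F. finite F \<Longrightarrow> F \<subseteq> B \<Longrightarrow> (\<Sum>(e, i)\<in>F \<times> I. (norm (T i e))\<^sup>2) \<le> b"
    using sq[of T, OF T] by auto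
  have "cmod (trace_op (\<Sum>i\<in>I. S i o\<^sub>L adj (T i))) \<le> sqrt a * sqrt b"
  proof (rule has_sum_cmod_le[OF trace_op_sum_compose_adj[OF B S T]])
    fix F assume F: "finite F" "F \<subseteq> B"
    have "cmod (\<Sum>e\<in>F. \<Sum>i\<in>I. cinner (S i e) (T i e))
        = cmod (\<Sum>p\<in>F \<times> I. cinner (S (snd p) (fst p)) (T (snd p) (fst p)))"
      by (simp add: sum.cartesian_product case_prod_unfold)
    also have "\<dots> \<le> sqrt (\<Sum>p\<in>F \<times> I. (norm (S (snd p) (fst p)))\<^sup>2)
        * sqrt (\<Sum>p\<in>F \<times> I. (norm (T (snd p) (fst p)))\<^sup>2)"
      by (rule norm_sum_cinner_le)
    also have "\<dots> \<le> sqrt a * sqrt b"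
      using a(3)[OF F] b(3)[OF F] \<open>a \<ge> 0\<close>
      by (intro mult_mono real_sqrt_le_mono) (simp_all add: case_prod_unfold sum_nonneg)
    finally show "cmod (\<Sum>e\<in>F. \<Sum>i\<in>I. cinner (S i e) (T i e)) \<le> sqrt a * sqrt b" .
  qed
  then have "(cmod (trace_op (\<Sum>i\<in>I. S i o\<^sub>L adj (T i))))\<^sup>2 \<le> (sqrt a * sqrt b)\<^sup>2"
    by (rule power_mono) simp
  also have "\<dots> = a * b"
    using a(1) b(1) by (simp add: power_mult_distrib)
  finally show ?thesis
    unfolding a(2) b(2) by (simp add: less_eq_complex_def flip: of_real_mult of_real_power)
qed

theorem theorem3p3:
  fixes S T :: "nat \<Rightarrow> ('a::complex_hilbert \<Rightarrow>\<^sub>L 'a)" and n :: nat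
  assumes "n \<ge> 1"
    and "\<And>i. i \<in> {1..n} \<Longrightarrow> trace_class (S i)"
    and "\<And>i. i \<in> {1..n} \<Longrightarrow> trace_class (T i)"
  shows "complex_of_real ((cmod (trace_op (\<Sum>i=1..n. S i o\<^sub>L adj (T i))))\<^sup>2)
    \<le> trace_op (\<Sum>i=1..n. S i o\<^sub>L adj (S i)) * trace_op (\<Sum>i=1..n. T i o\<^sub>L adj (T i))"
proof -
  have S: "Hilbert_Schmidt (S i)" and T: "Hilbert_Schmidt (T i)" if "i \<in> {1..n}" for i
    using assms(2,3)[OF that] by (simp_all add: trace_class_Hilbert_Schmidt)
  \<comment> \<open>As \<open>n \<ge> 1\<close>, there is an operator to take an orthonormal basis
    from: \<open>trace_class\<close> asserts that one exists.\<close>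
  have "trace_class (S 1)"
    using assms(1,2) by simp
  then obtain B :: "'a set" where "orthonormal_basis B"
    by (auto simp: trace_class_def)
  from Hilbert_Schmidt_trace_Cauchy_Schwarz[OF this S T] show ?thesis .
qed

end
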